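(* Let $\alpha\in(0,1)$ and $U=\prod_{i=1}^d[0,b_i]\subset\mathbb{R}^d$ with all $b_i>0$. Let $\Omega_{\mathrm{poly}}^\bullet(\mathbb{R}^d_y):=\mathbb{R}[y_1,\dots,y_d]\otimes\Lambda^\bullet(dy_1,\dots,dy_d)$ be the ordinary polynomial de Rham complex in the algebraically independent variables $y_1,\dots,y_d$, with differential $d$. Define the graded $\mathbb{R}$-linear map $\Phi:\Omega_\alpha^\bullet(U;\mathscr{P}_\alpha)\to\Omega_{\mathrm{poly}}^\bullet(\mathbb{R}^d_y)$ on monomial basis elements by $$\Phi\Bigl(\prod_{k=1}^d(X_k^\alpha)^{m_k}\,d^\alpha X_I\Bigr):=\Bigl(\prod_{k=1}^d\phi(m_k)\Bigr)y^{\mathbf{m}}\,dy_I,$$ where $y^{\mathbf m}=\prod_k y_k^{m_k}$, $dy_I=dy_{i_1}\wedge\cdots\wedge dy_{i_p}$ for $I=(i_1<\cdots<i_p)$, and $$\phi(m):=\frac{1}{m!}\,\frac{\Gamma(m\alpha+1)}{\Gamma(1+\alpha)^m},\qquad \phi(0):=1.$$ Then each $\phi(m)>0$, so $\Phi$ is a graded vector-space isomorphism, and $$\Phi\circ d^\alpha=d\circ\Phi.$$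
   Context: Let $X_i^\alpha(x)=x_i^\alpha/\Gamma(1+\alpha)$ and $\mathscr{P}_\alpha(U)=\mathbb{R}[X_1^\alpha,\dots,X_d^\alpha]$, the algebra of functions on $U$ generated by the $X_i^\alpha$. These functions are algebraically independent, so each element is uniquely a finite linear combination of monomials. The polynomial Caputo operator $\mathsf{D}_i^\alpha:\mathscr{P}_\alpha(U)\to\mathscr{P}_\alpha(U)$ is the $\mathbb{R}$-linear map defined on monomials $M=\prod_{k=1}^d(X_k^\alpha)^{m_k}$, $m_k\in\mathbb{Z}_{\ge0}$, by $$\mathsf{D}_i^\alpha M=\frac{\Gamma(m_i\alpha+1)}{\Gamma((m_i-1)\alpha+1)\Gamma(1+\alpha)}(X_i^\alpha)^{m_i-1}\prod_{j\ne i}(X_j^\alpha)^{m_j}\ \text{ if } m_i\ge1,\qquad \mathsf{D}_i^\alpha M=0\ \text{ if } m_i=0.$$ Let $d^\alpha X_1,\dots,d^\alpha X_d$ be formal degree-one generators with $d^\alpha X_i\wedge d^\alpha X_j=-d^\alpha X_j\wedge d^\alpha X_i$ and $d^\alpha X_i\wedge d^\alpha X_i=0$. For $I=(i_1<\dots<i_p)$ put $d^\alpha X_I=d^\alpha X_{i_1}\wedge\cdots\wedge d^\alpha X_{i_p}$, $\Omega_\alpha^p(U;\mathscr{P}_\alpha)=\bigoplus_{|I|=p}\mathscr{P}_\alpha(U)\,d^\alpha X_I$ and $\Omega_\alpha^\bullet=\bigoplus_{p=0}^d\Omega_\alpha^p$ (the exterior algebra over $\mathscr{P}_\alpha(U)$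 on these generators). The fractional exterior differential is $$d^\alpha\Bigl(\sum_{|I|=p}a_I\,d^\alpha X_I\Bigr)=\sum_{|I|=p}\sum_{i=1}^d(\mathsf{D}_i^\alpha a_I)\,d^\alpha X_i\wedge d^\alpha X_I .$$ *)

theory Defs
  imports
    "HOL-Analysis.Analysis"
    "HOL-Library.Function_Algebras"
    "HOL-Library.Poly_Mapping"
begin

abbreviation lookup :: "('a \<Rightarrow>\<^sub>0 'b::zero) \<Rightarrow> 'a \<Rightarrow> 'b" where
  "lookup \<equiv> Poly_Mapping.lookup"

abbreviation keys :: "('a \<Rightarrow>\<^sub>0 'b::zero) \<Rightarrow> 'a set" where
  "keys \<equiv> Poly_Mapping.keys"

subsection \<open>Exterior algebra on generators indexed by a finite linear order\<close>

text \<open>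
  A form over a coefficient ring is the family of its coefficients: the function \<open>\<omega>\<close>
  stands for the sum of all \<open>\<omega> I \<cdot> dX\<^sub>I\<close>, where the generators in \<open>dX\<^sub>I\<close> occur in increasing order.
  Addition of forms is the pointwise addition of \<open>HOL-Library.Function_Algebras\<close>; the pointwise
  product of that theory is \<^emph>\<open>not\<close> the product of forms.
\<close>

type_synonym ('n, 'r) form = "'n set \<Rightarrow> 'r"

definition basis_form :: "'n set \<Rightarrow> 'r::zero \<Rightarrow> ('n, 'r) form" where
  "basis_form I a = (\<lambda>J. if J = I then a else 0)"

text \<open>Sign of the permutation that sorts the concatenation of the increasing lists \<open>I\<close> and \<open>J\<close>.\<close>

definition shuffle_sign :: "'n::linorder set \<Rightarrow> 'n set \<Rightarrow> 'r::comm_ring_1" where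
  "shuffle_sign I J = (- 1) ^ card {(i, j). i \<in> I \<and> j \<in> J \<and> j < i}"

definition wedge :: "('n::{finite,linorder}, 'r::comm_ring_1) form \<Rightarrow> ('n, 'r) form \<Rightarrow> ('n, 'r) form"
  (infixl \<open>\<and>\<^sub>w\<close> 70) where
  "\<omega> \<and>\<^sub>w \<eta> = (\<lambda>K. \<Sum>I\<in>Pow K. shuffle_sign I (K - I) * \<omega> I * \<eta> (K - I))"

definition forms :: "'r set \<Rightarrow> ('n, 'r) form set" where
  "forms R = {\<omega>. \<forall>I. \<omega> I \<in> R}"

definition forms_deg :: "'r::zero set \<Rightarrow> nat \<Rightarrow> ('n, 'r) form set" where
  "forms_deg R p = {\<omega> \<in> forms R. \<forall>I. card I \<noteq> p \<longrightarrow> \<omega> I = 0}"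

text \<open>
  The differential induced by operators \<open>D i\<close> on the coefficients. The parameter \<open>e\<close> is the unit of the
  coefficient algebra, which may differ from the unit \<open>1\<close> of the ambient type.
\<close>

definition ext_diff :: "'r \<Rightarrow> ('n \<Rightarrow> 'r \<Rightarrow> 'r) \<Rightarrow>
    ('n::{finite,linorder}, 'r::comm_ring_1) form \<Rightarrow> ('n, 'r) form" where
  "ext_diff e D \<omega> = (\<Sum>I\<in>UNIV. \<Sum>i\<in>UNIV. basis_form {i} (D i (\<omega> I)) \<and>\<^sub>w basis_form I e)"


subsection \<open>The algebra of fractional polynomials\<close>

text \<open>
  A real function on \<open>U\<close> is represented by its extension by zero, so that functions on \<open>U\<close> are closed
  under pointwise sums and products; the constant function one becomes the indicator of \<open>U\<close>.
\<close>

definition frac_coord :: "real \<Rightarrow> 'n \<Rightarrow> real ^ 'n \<Rightarrow> real" where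
  "frac_coord \<alpha> i x = (x $ i) powr \<alpha> / Gamma (1 + \<alpha>)"

inductive_set frac_poly :: "real \<Rightarrow> (real ^ 'n) set \<Rightarrow> (real ^ 'n \<Rightarrow> real) set"
  for \<alpha> U where
  const: "(\<lambda>x. c * indicator U x) \<in> frac_poly \<alpha> U"
| coord: "(\<lambda>x. frac_coord \<alpha> i x * indicator U x) \<in> frac_poly \<alpha> U"
| add: "f \<in> frac_poly \<alpha> U \<Longrightarrow> g \<in> frac_poly \<alpha> U \<Longrightarrow> f + g \<in> frac_poly \<alpha> U"
| mult: "f \<in> frac_poly \<alpha> U \<Longrightarrow> g \<in> frac_poly \<alpha> U \<Longrightarrow> f * g \<in> frac_poly \<alpha> U"

definition frac_monom :: "real \<Rightarrow> (real ^ 'n) set \<Rightarrow> ('n \<Rightarrow>\<^sub>0 nat) \<Rightarrow> real ^ 'n \<Rightarrow> real" where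
  "frac_monom \<alpha> U m x = (\<Prod>k\<in>UNIV. frac_coord \<alpha> k x ^ lookup m k) * indicator U x"

text \<open>Polynomials in variables indexed by \<open>'n\<close>, with the convolution product of \<open>Poly_Mapping\<close>.\<close>

type_synonym 'n rpoly = "('n \<Rightarrow>\<^sub>0 nat) \<Rightarrow>\<^sub>0 real"

definition frac_comb :: "real \<Rightarrow> (real ^ 'n) set \<Rightarrow> 'n rpoly \<Rightarrow> real ^ 'n \<Rightarrow> real" where
  "frac_comb \<alpha> U c x = (\<Sum>m\<in>keys c. lookup c m * frac_monom \<alpha> U m x)"

text \<open>
  Coefficients with respect to the monomials. Existence and uniqueness on boxes are
  shown below (\<open>frac_poly_eq\<close> and \<open>frac_coeffs_comb\<close>).
\<close>

definition frac_coeffs :: "real \<Rightarrow> (real ^ 'n) set \<Rightarrow> (real ^ 'n \<Rightarrow> real) \<Rightarrow> 'n rpoly" where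
  "frac_coeffs \<alpha> U f = (THE c. f = frac_comb \<alpha> U c)"

definition caputo_monom ::
    "real \<Rightarrow> (real ^ 'n) set \<Rightarrow> 'n \<Rightarrow> ('n \<Rightarrow>\<^sub>0 nat) \<Rightarrow> real ^ 'n \<Rightarrow> real" where
  "caputo_monom \<alpha> U i m x =
     (if lookup m i = 0 then 0
      else Gamma (real (lookup m i) * \<alpha> + 1) /
             (Gamma ((real (lookup m i) - 1) * \<alpha> + 1) * Gamma (1 + \<alpha>)) *
           frac_coord \<alpha> i x ^ (lookup m i - 1) *
           (\<Prod>j\<in>UNIV - {i}. frac_coord \<alpha> j x ^ lookup m j) * indicator U x)"

definition caputo ::
    "real \<Rightarrow> (real ^ 'n) set \<Rightarrow> 'n \<Rightarrow> (real ^ 'n \<Rightarrow> real) \<Rightarrow> real ^ 'n \<Rightarrow> real" where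
  "caputo \<alpha> U i f x =
     (\<Sum>m\<in>keys (frac_coeffs \<alpha> U f). lookup (frac_coeffs \<alpha> U f) m * caputo_monom \<alpha> U i m x)"

definition frac_forms :: "real \<Rightarrow> (real ^ 'n) set \<Rightarrow> ('n, real ^ 'n \<Rightarrow> real) form set" where
  "frac_forms \<alpha> U = forms (frac_poly \<alpha> U)"

definition frac_forms_deg ::
    "real \<Rightarrow> (real ^ 'n) set \<Rightarrow> nat \<Rightarrow> ('n, real ^ 'n \<Rightarrow> real) form set" where
  "frac_forms_deg \<alpha> U p = forms_deg (frac_poly \<alpha> U) p"

definition frac_diff :: "real \<Rightarrow> (real, 'n::{finite,linorder}) vec set \<Rightarrow>
    ('n, (real, 'n) vec \<Rightarrow> real) form \<Rightarrow> ('n, (real, 'n) vec \<Rightarrow> real) form" where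
  "frac_diff \<alpha> U = ext_diff (indicator U) (caputo \<alpha> U)"


subsection \<open>The polynomial de Rham complex\<close>

definition partial_deriv :: "'n \<Rightarrow> 'n rpoly \<Rightarrow> 'n rpoly" where
  "partial_deriv i p =
     (\<Sum>m\<in>keys p. Poly_Mapping.single (m - Poly_Mapping.single i 1) (real (lookup m i) * lookup p m))"

definition poly_diff :: "('n::{finite,linorder}, 'n rpoly) form \<Rightarrow> ('n, 'n rpoly) form" where
  "poly_diff = ext_diff 1 partial_deriv"


subsection \<open>The comparison map\<close>

text \<open>The formula also gives the value \<open>1\<close> at \<open>m = 0\<close>.\<close>

definition phi :: "real \<Rightarrow> nat \<Rightarrow> real" where
  "phi \<alpha> m = 1 / fact m * (Gamma (real m * \<alpha> + 1) / Gamma (1 + \<alpha>) ^ m)"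

definition Phi_monom :: "real \<Rightarrow> ('n::finite \<Rightarrow>\<^sub>0 nat) \<Rightarrow> 'n rpoly" where
  "Phi_monom \<alpha> m = Poly_Mapping.single m (\<Prod>k\<in>UNIV. phi \<alpha> (lookup m k))"

text \<open>
  Linear extension of \<open>X\<^sup>m dX\<^sub>I \<mapsto> (\<Prod>k. \<phi> m\<^sub>k) y\<^sup>m dy\<^sub>I\<close>; the scalar \<open>c\<close> of a real polynomial algebra is
  the constant polynomial \<open>Poly_Mapping.single 0 c\<close>.
\<close>

definition Phi :: "real \<Rightarrow> (real ^ 'n) set \<Rightarrow>
    ('n, real ^ 'n \<Rightarrow> real) form \<Rightarrow> ('n, 'n rpoly) form" where
  "Phi \<alpha> U \<omega> = (\<Sum>I\<in>UNIV. \<Sum>m\<in>keys (frac_coeffs \<alpha> U (\<omega> I)).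
     basis_form I (Poly_Mapping.single 0 (lookup (frac_coeffs \<alpha> U (\<omega> I)) m) * Phi_monom \<alpha> m))"


subsection \<open>Basic properties of the definitions\<close>

lemma phi_0: "phi \<alpha> 0 = 1"
  by (simp add: phi_def)

lemma wedge_basis_form:
  "basis_form I a \<and>\<^sub>w basis_form J b =
     (if I \<inter> J = {} then basis_form (I \<union> J) (shuffle_sign I J * a * b) else 0)"
proof
  fix K
  have "(basis_form I a \<and>\<^sub>w basis_form J b) K =
      (\<Sum>I'\<in>Pow K. if I' = I then shuffle_sign I (K - I) * a * (if K - I = J then b else 0) else 0)"
    unfolding wedge_def basis_form_def by (rule sum.cong) auto
  also have "\<dots> = (if I \<subseteq> K \<and> K - I = J then shuffle_sign I J * a * b else 0)"
    by (subst sum.delta) auto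
  also have "\<dots> = (if I \<inter> J = {} then basis_form (I \<union> J) (shuffle_sign I J * a * b) else 0) K"
    unfolding basis_form_def by (auto simp: zero_fun_def)
  finally show "(basis_form I a \<and>\<^sub>w basis_form J b) K =
      (if I \<inter> J = {} then basis_form (I \<union> J) (shuffle_sign I J * a * b) else 0) K" .
qed

lemma shuffle_sign_less:
  assumes "\<And>i j. i \<in> I \<Longrightarrow> j \<in> J \<Longrightarrow> i < j"
  shows "shuffle_sign I J = 1"
proof -
  have *: "{(i, j). i \<in> I \<and> j \<in> J \<and> j < i} = {}"
    using assms by (auto dest: order.asym)
  show ?thesis
    unfolding shuffle_sign_def * by simp
qed

text \<open>The basis form of an increasing list of generators is their exterior product.\<close>

lemma basis_form_insert:
  assumes "\<And>j. j \<in> I \<Longrightarrow> i < j"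
  shows "basis_form (insert i I) (1::'r::comm_ring_1) = basis_form {i} 1 \<and>\<^sub>w basis_form I 1"
proof -
  have "i \<notin> I"
    using assms by blast
  moreover have "shuffle_sign {i} I = (1::'r)"
    by (rule shuffle_sign_less) (use assms in auto)
  ultimately show ?thesis
    by (simp add: wedge_basis_form)
qed

lemma wedge_generators_self: "basis_form {i} a \<and>\<^sub>w basis_form {i} b = 0"
  by (simp add: wedge_basis_form)

lemma wedge_generators_anticomm:
  "basis_form {i} 1 \<and>\<^sub>w basis_form {j} 1 = - (basis_form {j} 1 \<and>\<^sub>w basis_form {i} (1::'r::comm_ring_1))"
proof -
  have *: "basis_form {i} 1 \<and>\<^sub>w basis_form {j} 1 = - (basis_form {j} 1 \<and>\<^sub>w basis_form {i} (1::'r))"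
    if "i < j" for i j :: 'a
  proof -
    have *: "{(k, l). k \<in> {j} \<and> l \<in> {i} \<and> l < k} = {(j, i)}"
      using that by auto
    have "shuffle_sign {j} {i} = (- 1 :: 'r)"
      unfolding shuffle_sign_def * by simp
    moreover have "shuffle_sign {i} {j} = (1 :: 'r)"
      by (rule shuffle_sign_less) (use that in auto)
    ultimately have "basis_form {i} 1 \<and>\<^sub>w basis_form {j} 1 = basis_form {i, j} (1 :: 'r)"
      "basis_form {j} 1 \<and>\<^sub>w basis_form {i} 1 = basis_form {i, j} (- 1 :: 'r)"
      using that by (auto simp: wedge_basis_form insert_commute)
    then show ?thesis
      by (simp add: basis_form_def fun_eq_iff)
  qed
  show ?thesis
  proof (cases i j rule: linorder_cases)
    case less
    then show ?thesis by (rule *)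
  next
    case equal
    then show ?thesis by (simp add: wedge_generators_self)
  next
    case greater
    then show ?thesis using *[of j i] by simp
  qed
qed

lemma frac_comb_superset:
  assumes "finite K" "keys c \<subseteq> K"
  shows "frac_comb \<alpha> U c x = (\<Sum>m\<in>K. lookup c m * frac_monom \<alpha> U m x)"
  unfolding frac_comb_def
  by (rule sum.mono_neutral_left) (use assms in \<open>auto simp: in_keys_iff\<close>)

lemma frac_comb_add: "frac_comb \<alpha> U (c + d) = frac_comb \<alpha> U c + frac_comb \<alpha> U d"
proof
  fix x
  have "keys (c + d) \<subseteq> keys c \<union> keys d"
    by (rule keys_add)
  then show "frac_comb \<alpha> U (c + d) x = (frac_comb \<alpha> U c + frac_comb \<alpha> U d) x"
    by (simp add: frac_comb_superset[of "keys c \<union> keys d"] lookup_add sum.distrib algebra_simps)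
qed

lemma frac_comb_0: "frac_comb \<alpha> U 0 = 0"
  by (simp add: fun_eq_iff frac_comb_def)

lemma frac_comb_sum: "frac_comb \<alpha> U (\<Sum>a\<in>A. c a) = (\<Sum>a\<in>A. frac_comb \<alpha> U (c a))"
  by (induction A rule: infinite_finite_induct) (simp_all add: frac_comb_0 frac_comb_add)

lemma frac_comb_single:
  "frac_comb \<alpha> U (Poly_Mapping.single m r) = (\<lambda>x. r * frac_monom \<alpha> U m x)"
  by (simp add: fun_eq_iff frac_comb_def)

lemma frac_monom_add: "frac_monom \<alpha> U (m + n) = frac_monom \<alpha> U m * frac_monom \<alpha> U n"
  by (auto simp: fun_eq_iff frac_monom_def lookup_add power_add prod.distrib indicator_def)

lemma frac_monom_in_frac_poly: "frac_monom \<alpha> U m \<in> frac_poly \<alpha> U"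
proof -
  have pow: "(\<lambda>x. frac_coord \<alpha> i x ^ n * indicator U x) \<in> frac_poly \<alpha> U" for i n
  proof (induction n)
    case 0
    then show ?case using frac_poly.const[of 1 U \<alpha>] by simp
  next
    case (Suc n)
    from frac_poly.mult[OF frac_poly.coord[of \<alpha> i U] this] show ?case
      by (rule back_subst[where P = "\<lambda>f. f \<in> frac_poly \<alpha> U"])
        (auto simp: fun_eq_iff indicator_def)
  qed
  have "(\<lambda>x. (\<Prod>k\<in>S. frac_coord \<alpha> k x ^ lookup m k) * indicator U x) \<in> frac_poly \<alpha> U"
    if "finite S" for S
    using that
  proof induction
    case empty
    then show ?case using frac_poly.const[of 1 U \<alpha>] by simp
  next
    case (insert i S)
    from frac_poly.mult[OF pow[of i "lookup m i"] insert.IH] show ?case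
      by (rule back_subst[where P = "\<lambda>f. f \<in> frac_poly \<alpha> U"])
        (use insert.hyps in \<open>auto simp: fun_eq_iff indicator_def\<close>)
  qed
  from this[of UNIV] show ?thesis
    by (simp add: frac_monom_def[abs_def])
qed

lemma frac_comb_in_frac_poly: "frac_comb \<alpha> U c \<in> frac_poly \<alpha> U"
proof -
  have "(\<Sum>m\<in>K. (\<lambda>x. lookup c m * frac_monom \<alpha> U m x)) \<in> frac_poly \<alpha> U" if "finite K" for K
    using that
  proof induction
    case empty
    then show ?case using frac_poly.const[of 0 U \<alpha>] by (simp add: zero_fun_def)
  next
    case (insert m K)
    from frac_poly.mult[OF frac_poly.const[of "lookup c m"] frac_monom_in_frac_poly[of \<alpha> U m]]
    have "(\<lambda>x. lookup c m * frac_monom \<alpha> U m x) \<in> frac_poly \<alpha> U"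
      by (rule back_subst[where P = "\<lambda>f. f \<in> frac_poly \<alpha> U"])
        (auto simp: fun_eq_iff frac_monom_def indicator_def)
    from frac_poly.add[OF this insert.IH] show ?case
      using insert.hyps by (simp only: sum.insert not_False_eq_True)
  qed
  moreover have "frac_comb \<alpha> U c = (\<Sum>m\<in>keys c. (\<lambda>x. lookup c m * frac_monom \<alpha> U m x))"
  proof -
    have "(\<Sum>m\<in>K. (\<lambda>x. lookup c m * frac_monom \<alpha> U m x)) y =
        (\<Sum>m\<in>K. lookup c m * frac_monom \<alpha> U m y)" for K y
      by (induction K rule: infinite_finite_induct) auto
    then show ?thesis
      by (simp add: fun_eq_iff frac_comb_def)
  qed
  ultimately show ?thesis
    by simp
qed

lemma frac_comb_mult: "\<exists>e. frac_comb \<alpha> U c * frac_comb \<alpha> U d = frac_comb \<alpha> U e"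
proof
  have sum_app: "(\<Sum>a\<in>A. g a) x = (\<Sum>a\<in>A. g a x)" for A and g :: "'b \<Rightarrow> 'c \<Rightarrow> real" and x
    by (induction A rule: infinite_finite_induct) auto
  let ?e = "\<Sum>m\<in>keys c. \<Sum>n\<in>keys d. Poly_Mapping.single (m + n) (lookup c m * lookup d n)"
  show "frac_comb \<alpha> U c * frac_comb \<alpha> U d = frac_comb \<alpha> U ?e"
  proof
    fix x
    have "frac_comb \<alpha> U ?e x = (\<Sum>m\<in>keys c. \<Sum>n\<in>keys d.
        lookup c m * lookup d n * frac_monom \<alpha> U (m + n) x)"
      by (simp add: frac_comb_sum frac_comb_single sum_app)
    also have "\<dots> = (\<Sum>m\<in>keys c. \<Sum>n\<in>keys d.
        (lookup c m * frac_monom \<alpha> U m x) * (lookup d n * frac_monom \<alpha> U n x))"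
      by (simp add: frac_monom_add algebra_simps)
    finally show "(frac_comb \<alpha> U c * frac_comb \<alpha> U d) x = frac_comb \<alpha> U ?e x"
      by (simp add: frac_comb_def sum_product)
  qed
qed

lemma frac_poly_eq: "frac_poly \<alpha> U = frac_comb \<alpha> U ` UNIV"
proof (intro equalityI subsetI)
  fix f assume "f \<in> frac_poly \<alpha> U"
  then show "f \<in> frac_comb \<alpha> U ` UNIV"
  proof induction
    case (const c)
    have "(\<lambda>x. c * indicator U x) = frac_comb \<alpha> U (Poly_Mapping.single 0 c)"
      by (simp add: frac_comb_single frac_monom_def)
    then show ?case by (rule image_eqI) simp
  next
    case (coord i)
    have "frac_monom \<alpha> U (Poly_Mapping.single i 1) x = frac_coord \<alpha> i x * indicator U x" for x
    proof -
      have "(\<Prod>k\<in>UNIV. frac_coord \<alpha> k x ^ lookup (Poly_Mapping.single i 1) k) =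
          (\<Prod>k\<in>UNIV. if k = i then frac_coord \<alpha> k x else 1)"
        by (rule prod.cong) (auto simp: lookup_single when_def)
      then show ?thesis by (simp add: frac_monom_def)
    qed
    then have "(\<lambda>x. frac_coord \<alpha> i x * indicator U x) =
        frac_comb \<alpha> U (Poly_Mapping.single (Poly_Mapping.single i 1) 1)"
      by (simp add: frac_comb_single)
    then show ?case by (rule image_eqI) simp
  next
    case (add f g)
    then obtain c d where "f = frac_comb \<alpha> U c" "g = frac_comb \<alpha> U d"
      by blast
    then have "f + g = frac_comb \<alpha> U (c + d)"
      by (simp only: frac_comb_add)
    then show ?case by (rule image_eqI) simp
  next
    case (mult f g)
    then show ?case using frac_comb_mult by fastforce
  qed
qed (auto intro: frac_comb_in_frac_poly)

text \<open>Algebraic independence.\<close>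

lemma monomials_independent:
  fixes a :: "'n \<Rightarrow> real" and c :: "('n \<Rightarrow> nat) \<Rightarrow> real"
  assumes "finite S" "\<And>i. i \<in> S \<Longrightarrow> 0 < a i" "finite K"
    "\<And>m n. m \<in> K \<Longrightarrow> n \<in> K \<Longrightarrow> (\<And>i. i \<in> S \<Longrightarrow> m i = n i) \<Longrightarrow> m = n"
    "\<And>z. (\<And>i. i \<in> S \<Longrightarrow> 0 < z i \<and> z i < a i) \<Longrightarrow> (\<Sum>m\<in>K. c m * (\<Prod>i\<in>S. z i ^ m i)) = 0"
    "m \<in> K"
  shows "c m = 0"
  using assms
proof (induction S arbitrary: K m rule: finite_induct)
  case empty
  then have "K = {m}"
    by blast
  then show ?case using empty.prems(4)[of a] by simp
next
  case (insert j S)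
  define k where "k = m j"
  define K' where "K' = {m \<in> K. m j = k}"
  have "m = n" if "m \<in> K'" "n \<in> K'" "\<And>i. i \<in> S \<Longrightarrow> m i = n i" for m n
    using that by (intro insert.prems(3)) (auto simp: K'_def)
  moreover have "(\<Sum>m\<in>K'. c m * (\<Prod>i\<in>S. z i ^ m i)) = 0"
    if z: "\<And>i. i \<in> S \<Longrightarrow> 0 < z i \<and> z i < a i" for z
  proof -
    define p where "p = (\<Sum>m\<in>K. monom (c m * (\<Prod>i\<in>S. z i ^ m i)) (m j))"
    have "poly p t = 0" if t: "t \<in> {0<..<a j}" for t
    proof -
      let ?z = "z(j := t)"
      have "(\<Sum>m\<in>K. c m * (\<Prod>i\<in>insert j S. ?z i ^ m i)) = 0"
        by (rule insert.prems(4)) (use z t in auto)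
      moreover have "(\<Prod>i\<in>insert j S. ?z i ^ m i) = t ^ m j * (\<Prod>i\<in>S. z i ^ m i)" for m
      proof -
        have "(\<Prod>i\<in>S. ?z i ^ m i) = (\<Prod>i\<in>S. z i ^ m i)"
          by (rule prod.cong) (use insert.hyps in auto)
        then show ?thesis using insert.hyps by simp
      qed
      ultimately show ?thesis
        by (simp add: p_def poly_sum poly_monom algebra_simps)
    qed
    moreover have "infinite {0<..<a j}"
      using insert.prems(1)[of j] by (simp add: infinite_Ioo)
    ultimately have "p = 0"
      using poly_roots_finite[of p] finite_subset[of "{0<..<a j}" "{t. poly p t = 0}"] by blast
    then have "coeff p k = 0"
      by simp
    moreover have "coeff p k = (\<Sum>m\<in>K. if m j = k then c m * (\<Prod>i\<in>S. z i ^ m i) else 0)"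
      by (simp add: p_def coeff_sum)
    ultimately show ?thesis
      using insert.prems(2) by (simp add: K'_def sum.inter_filter)
  qed
  ultimately show ?case
    by (intro insert.IH[of K'])
      (use insert.prems(1,2,5) in \<open>auto simp: K'_def k_def\<close>)
qed

lemma frac_comb_eq_0D:
  fixes b :: "real ^ 'n"
  assumes \<alpha>: "0 < \<alpha>" and b: "\<forall>i. 0 < b $ i" and U: "U = {x. \<forall>i. 0 \<le> x $ i \<and> x $ i \<le> b $ i}"
    and 0: "frac_comb \<alpha> U c = 0"
  shows "c = 0"
proof (rule poly_mapping_eqI)
  fix m
  have G: "Gamma (1 + \<alpha>) > 0"
    using \<alpha> by (intro Gamma_real_pos) simp
  define a where "a i = (b $ i) powr \<alpha> / Gamma (1 + \<alpha>)" for i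
  show "lookup c m = lookup 0 m"
  proof (cases "m \<in> keys c")
    case True
    have "(\<lambda>m. lookup c (Abs_poly_mapping m)) (lookup m) = 0"
    proof (rule monomials_independent[where S = UNIV and a = a and K = "lookup ` keys c"])
      show "0 < a i" for i
        using b[rule_format, of i] G by (simp add: a_def)
      show "f = g" if "f \<in> lookup ` keys c" "g \<in> lookup ` keys c" "\<And>i. i \<in> UNIV \<Longrightarrow> f i = g i" for f g
        using that by auto
      show "lookup m \<in> lookup ` keys c"
        using True by simp
      fix z assume z: "\<And>i. i \<in> UNIV \<Longrightarrow> 0 < z i \<and> z i < a i"
      define x :: "real ^ 'n" where "x = (\<chi> i. (z i * Gamma (1 + \<alpha>)) powr (1 / \<alpha>))"
      have coord: "frac_coord \<alpha> i x = z i" for i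
        using z[of i] G less_imp_neq[OF G] \<alpha> by (simp add: frac_coord_def x_def powr_powr)
      have "x $ i \<le> b $ i" for i
      proof -
        have "z i * Gamma (1 + \<alpha>) \<le> (b $ i) powr \<alpha>"
          using z[of i] G by (simp add: a_def field_simps)
        then have "(z i * Gamma (1 + \<alpha>)) powr (1 / \<alpha>) \<le> ((b $ i) powr \<alpha>) powr (1 / \<alpha>)"
          using z[of i] G \<alpha> by (intro powr_mono2) (auto simp: less_imp_le)
        then show ?thesis
          using \<alpha> b by (simp add: x_def powr_powr less_imp_le)
      qed
      then have "x \<in> U"
        by (simp add: U x_def)
      then have "(\<Sum>m\<in>keys c. lookup c m * (\<Prod>i\<in>UNIV. z i ^ lookup m i)) = frac_comb \<alpha> U c x"
        by (simp add: frac_comb_def frac_monom_def coord)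
      moreover have "inj_on lookup (keys c)"
        by (simp add: inj_on_def)
      ultimately show "(\<Sum>m\<in>lookup ` keys c. lookup c (Abs_poly_mapping m) * (\<Prod>i\<in>UNIV. z i ^ m i)) = 0"
        using 0 by (simp add: sum.reindex lookup_inverse)
    qed simp_all
    then show ?thesis
      by (simp add: lookup_inverse)
  qed (simp add: in_keys_iff)
qed

lemma frac_coeffs_comb:
  fixes b :: "real ^ 'n"
  assumes "0 < \<alpha>" "\<forall>i. 0 < b $ i" "U = {x. \<forall>i. 0 \<le> x $ i \<and> x $ i \<le> b $ i}"
  shows "frac_coeffs \<alpha> U (frac_comb \<alpha> U c) = c"
  unfolding frac_coeffs_def
proof (rule the_equality)
  fix d assume eq: "frac_comb \<alpha> U c = frac_comb \<alpha> U d"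
  have "frac_comb \<alpha> U d = frac_comb \<alpha> U (d - c) + frac_comb \<alpha> U c"
    by (simp add: frac_comb_add[symmetric])
  then have "frac_comb \<alpha> U (d - c) = 0"
    using eq by simp
  then have "d - c = 0"
    by (rule frac_comb_eq_0D[OF assms])
  then show "d = c"
    by simp
qed simp

lemma frac_coeffs_monom:
  fixes b :: "real ^ 'n"
  assumes "0 < \<alpha>" "\<forall>i. 0 < b $ i" "U = {x. \<forall>i. 0 \<le> x $ i \<and> x $ i \<le> b $ i}"
  shows "frac_coeffs \<alpha> U (frac_monom \<alpha> U m) = Poly_Mapping.single m 1"
  using frac_coeffs_comb[OF assms, of "Poly_Mapping.single m 1"] by (simp add: frac_comb_single)

lemma caputo_frac_monom:
  fixes b :: "real ^ 'n"
  assumes "0 < \<alpha>" "\<forall>i. 0 < b $ i" "U = {x. \<forall>i. 0 \<le> x $ i \<and> x $ i \<le> b $ i}"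
  shows "caputo \<alpha> U i (frac_monom \<alpha> U m) = caputo_monom \<alpha> U i m"
  by (simp add: caputo_def fun_eq_iff frac_coeffs_monom[OF assms])

lemma Phi_basis_form:
  fixes b :: "real ^ 'n"
  assumes "0 < \<alpha>" "\<forall>i. 0 < b $ i" "U = {x. \<forall>i. 0 \<le> x $ i \<and> x $ i \<le> b $ i}"
  shows "Phi \<alpha> U (basis_form I (frac_monom \<alpha> U m)) = basis_form I (Phi_monom \<alpha> m)"
proof -
  have zero: "frac_coeffs \<alpha> U 0 = 0"
    using frac_coeffs_comb[OF assms, of 0] by (simp add: frac_comb_0)
  have "Phi \<alpha> U (basis_form I (frac_monom \<alpha> U m)) =
      (\<Sum>J\<in>UNIV. if J = I then basis_form I (Phi_monom \<alpha> m) else 0)"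
    unfolding Phi_def
  proof (rule sum.cong)
    fix J
    show "(\<Sum>n\<in>keys (frac_coeffs \<alpha> U (basis_form I (frac_monom \<alpha> U m) J)).
        basis_form J (Poly_Mapping.single 0 (lookup (frac_coeffs \<alpha> U
          (basis_form I (frac_monom \<alpha> U m) J)) n) * Phi_monom \<alpha> n)) =
        (if J = I then basis_form I (Phi_monom \<alpha> m) else 0)"
    proof (cases "J = I")
      case True
      then have "frac_coeffs \<alpha> U (basis_form I (frac_monom \<alpha> U m) J) = Poly_Mapping.single m 1"
        using frac_coeffs_monom[OF assms, of m] by (simp add: basis_form_def)
      with True show ?thesis by simp
    next
      case False
      then have "basis_form I (frac_monom \<alpha> U m) J = 0"
        by (simp add: basis_form_def)
      with False show ?thesis by (simp only: zero) simp
    qed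
  qed simp
  then show ?thesis
    by simp
qed

end

theory Submission
  imports Defs
begin

text \<open>
  The comparison map does not mix the basis forms: on the coefficient of each \<open>dX\<^sub>I\<close> it is one and the
  same map \<open>Phi_coeff\<close>, which reads a fractional polynomial as a polynomial in \<open>y\<close> (possible because the
  monomials are linearly independent on a box) and then multiplies the coefficient of \<open>y\<^sup>m\<close> by the weight
  \<open>\<Prod>k. \<phi> m\<^sub>k\<close>. Both steps are linear and the second one is invertible because \<open>\<phi>\<close> takes positive
  values, so \<open>Phi\<close> is an isomorphism, and it preserves degrees since it acts on each \<open>I\<close> separately.

  Compatibility with the differentials also reduces to a statement on coefficients. Both differentials
  are built from their coefficient operators by the same signed sum (\<open>ext_diff_apply\<close>), so it suffices
  that \<open>Phi_coeff\<close> turns the Caputo operator into the ordinary partial derivative. Each of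
  the two operators lowers the exponent \<open>k\<close> of the chosen variable by one and multiplies by a factor:
  a quotient of Gamma values \<open>\<kappa> k\<close> for Caputo, and \<open>k\<close> for the derivative. The weight \<open>\<phi>\<close> is the solution
  with \<open>\<phi> 0 = 1\<close> of the recursion \<open>\<phi> (k - 1) * \<kappa> k = k * \<phi> k\<close> (\<open>phi_caputo_factor\<close>), which
  is exactly what the intertwining requires (\<open>rescale_weighted_partial\<close>).
\<close>

section \<open>Forms, coefficient by coefficient\<close>

lemma sum_fun_apply: "(\<Sum>a\<in>A. g a) x = (\<Sum>a\<in>A. g a x)"
  for g :: "'a \<Rightarrow> 'b \<Rightarrow> 'c::comm_monoid_add"
  by (induction A rule: infinite_finite_induct) auto

text \<open>
  A term \<open>dX\<^sub>i \<and> dX\<^sub>I\<close> contributes to \<open>dX\<^sub>K\<close> only if \<open>i \<notin> I\<close> and \<open>K = insert i I\<close>, so \<open>i\<close> ranges over \<open>K\<close>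
  and determines \<open>I = K - {i}\<close>. In this form linear maps of the coefficients can be compared with
  the differential at one \<open>K\<close> at a time.
\<close>

lemma ext_diff_apply:
  "ext_diff e D \<omega> K = (\<Sum>i\<in>K. shuffle_sign {i} (K - {i}) * D i (\<omega> (K - {i})) * e)"
proof -
  let ?t = "\<lambda>i I. shuffle_sign {i} I * D i (\<omega> I) * e"
  have "ext_diff e D \<omega> K = (\<Sum>I\<in>UNIV. \<Sum>i\<in>UNIV. if i \<notin> I \<and> K = insert i I then ?t i I else 0)"
    unfolding ext_diff_def sum_fun_apply wedge_basis_form
    by (intro sum.cong) (auto simp: basis_form_def)
  also have "\<dots> = (\<Sum>i\<in>UNIV. \<Sum>I\<in>UNIV. if i \<notin> I \<and> K = insert i I then ?t i I else 0)"
    by (rule sum.swap)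
  also have "\<dots> = (\<Sum>i\<in>UNIV. \<Sum>I\<in>UNIV. if I = K - {i} then if i \<in> K then ?t i I else 0 else 0)"
    by (intro sum.cong refl) auto
  also have "\<dots> = (\<Sum>i\<in>UNIV. if i \<in> K then ?t i (K - {i}) else 0)"
    by simp
  also have "\<dots> = (\<Sum>i\<in>K. ?t i (K - {i}))"
    by (simp add: sum.If_cases)
  finally show ?thesis .
qed

lemma bij_betw_forms:
  assumes "bij_betw g R S"
  shows "bij_betw (\<lambda>\<omega> I. g (\<omega> I)) (forms R) (forms S)"
proof (rule bij_betw_byWitness[where f' = "\<lambda>\<eta> I. inv_into R g (\<eta> I)"])
  show "\<forall>\<omega>\<in>forms R. (\<lambda>I. inv_into R g (g (\<omega> I))) = \<omega>"
    using assms by (auto simp: forms_def bij_betw_inv_into_left)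
  show "\<forall>\<eta>\<in>forms S. (\<lambda>I. g (inv_into R g (\<eta> I))) = \<eta>"
    using assms by (auto simp: forms_def bij_betw_inv_into_right)
  show "(\<lambda>\<omega> I. g (\<omega> I)) ` forms R \<subseteq> forms S"
    using assms by (auto simp: forms_def bij_betw_apply)
  show "(\<lambda>\<eta> I. inv_into R g (\<eta> I)) ` forms S \<subseteq> forms R"
    using assms by (auto simp: forms_def bij_betw_imp_surj_on inv_into_into)
qed

text \<open>
  Since \<open>g\<close> is injective and fixes zero, a form and its image vanish at the same index sets.
\<close>

lemma bij_betw_forms_deg:
  assumes g: "bij_betw g R S" and 0: "0 \<in> R" "g 0 = 0"
  shows "bij_betw (\<lambda>\<omega> I. g (\<omega> I)) (forms_deg R p) (forms_deg S p)"
proof -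
  have zero_iff: "g a = 0 \<longleftrightarrow> a = 0" if "a \<in> R" for a
    using g 0 that by (metis bij_betw_imp_inj_on inj_onD)
  have "(\<lambda>\<omega> I. g (\<omega> I)) ` forms_deg R p = forms_deg S p"
  proof
    show "(\<lambda>\<omega> I. g (\<omega> I)) ` forms_deg R p \<subseteq> forms_deg S p"
      using g 0 by (auto simp: forms_deg_def forms_def bij_betw_apply)
    show "forms_deg S p \<subseteq> (\<lambda>\<omega> I. g (\<omega> I)) ` forms_deg R p"
    proof
      fix \<eta> assume \<eta>: "\<eta> \<in> forms_deg S p"
      then have "\<eta> \<in> (\<lambda>\<omega> I. g (\<omega> I)) ` forms R"
        unfolding bij_betw_imp_surj_on[OF bij_betw_forms[OF g]] by (simp add: forms_deg_def)
      then obtain \<omega> where "\<omega> \<in> forms R" "\<eta> = (\<lambda>I. g (\<omega> I))"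
        by blast
      with \<eta> zero_iff have "\<omega> \<in> forms_deg R p"
        by (auto simp: forms_deg_def forms_def)
      with \<open>\<eta> = _\<close> show "\<eta> \<in> (\<lambda>\<omega> I. g (\<omega> I)) ` forms_deg R p"
        by blast
    qed
  qed
  moreover have "inj_on (\<lambda>\<omega> I. g (\<omega> I)) (forms_deg R p)"
    using bij_betw_forms[OF g]
    by (auto simp: bij_betw_def forms_deg_def intro: inj_on_subset)
  ultimately show ?thesis
    by (simp add: bij_betw_def)
qed


section \<open>Rescaling the monomials of a polynomial\<close>

definition phi_weight :: "real \<Rightarrow> ('n::finite \<Rightarrow>\<^sub>0 nat) \<Rightarrow> real" where
  "phi_weight \<alpha> m = (\<Prod>k\<in>UNIV. phi \<alpha> (lookup m k))"

definition rescale :: "('a \<Rightarrow> real) \<Rightarrow> ('a \<Rightarrow>\<^sub>0 real) \<Rightarrow> 'a \<Rightarrow>\<^sub>0 real" where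
  "rescale w = Poly_Mapping.mapp (\<lambda>m r. w m * r)"

lemma lookup_rescale: "lookup (rescale w p) m = w m * lookup p m"
  by (simp add: rescale_def lookup_mapp when_def in_keys_iff)

lemma rescale_0: "rescale w 0 = 0"
  by (rule poly_mapping_eqI) (simp add: lookup_rescale)

lemma rescale_add: "rescale w (p + q) = rescale w p + rescale w q"
  by (rule poly_mapping_eqI) (simp add: lookup_rescale lookup_add algebra_simps)

lemma rescale_sum: "rescale w (\<Sum>a\<in>A. p a) = (\<Sum>a\<in>A. rescale w (p a))"
  by (induction A rule: infinite_finite_induct) (simp_all add: rescale_0 rescale_add)

lemma rescale_single: "rescale w (Poly_Mapping.single m r) = Poly_Mapping.single m (w m * r)"
  by (rule poly_mapping_eqI) (simp add: lookup_rescale lookup_single when_def)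

lemma poly_mapping_sum_single: "p = (\<Sum>m\<in>keys p. Poly_Mapping.single m (lookup p m))"
  by (rule poly_mapping_eqI) (simp add: lookup_sum lookup_single when_def in_keys_iff)

lemma lookup_single_0_times:
  fixes p :: "'a::monoid_add \<Rightarrow>\<^sub>0 real"
  shows "lookup (Poly_Mapping.single 0 r * p) m = r * lookup p m"
  by (simp add: mult_map_scale_conv_mult[symmetric] map.rep_eq when_def)

lemma rescale_single_0_times:
  fixes p :: "'a::monoid_add \<Rightarrow>\<^sub>0 real"
  shows "rescale w (Poly_Mapping.single 0 r * p) = Poly_Mapping.single 0 r * rescale w p"
  by (rule poly_mapping_eqI) (simp add: lookup_rescale lookup_single_0_times)

lemma bij_rescale:
  assumes "\<And>m. w m \<noteq> 0"
  shows "bij (rescale w)"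
proof (rule bij_betw_byWitness[where f' = "rescale (\<lambda>m. inverse (w m))"])
  show "\<forall>p\<in>UNIV. rescale (\<lambda>m. inverse (w m)) (rescale w p) = p"
    "\<forall>p\<in>UNIV. rescale w (rescale (\<lambda>m. inverse (w m)) p) = p"
    using assms by (auto intro!: poly_mapping_eqI simp: lookup_rescale)
qed auto

lemma phi_pos:
  assumes "0 < \<alpha>"
  shows "0 < phi \<alpha> m"
  using assms unfolding phi_def
  by (intro mult_pos_pos divide_pos_pos zero_less_power Gamma_real_pos)
     (auto intro: add_nonneg_pos)

lemma phi_weight_pos: "0 < \<alpha> \<Longrightarrow> 0 < phi_weight \<alpha> m"
  by (simp add: phi_weight_def phi_pos prod_pos)


section \<open>Caputo operators on coefficients\<close>

text \<open>
  The counterpart of the factor \<open>k\<close> in the ordinary derivative of a \<open>k\<close>-th power. Its value zero at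
  \<open>k = 0\<close> absorbs the case distinction in the Caputo operator.
\<close>

definition caputo_factor :: "real \<Rightarrow> nat \<Rightarrow> real" where
  "caputo_factor \<alpha> k =
     (if k = 0 then 0
      else Gamma (real k * \<alpha> + 1) / (Gamma ((real k - 1) * \<alpha> + 1) * Gamma (1 + \<alpha>)))"

text \<open>
  The partial derivative with the derivative \<open>k * y ^ (k - 1)\<close> of a power replaced by
  \<open>v k * y ^ (k - 1)\<close>. The choice \<open>v = caputo_factor \<alpha>\<close> gives the Caputo operator on coefficients.
\<close>

definition weighted_partial :: "(nat \<Rightarrow> real) \<Rightarrow> 'n \<Rightarrow> 'n rpoly \<Rightarrow> 'n rpoly" where
  "weighted_partial v i p =
     (\<Sum>m\<in>keys p. Poly_Mapping.single (m - Poly_Mapping.single i 1) (v (lookup m i) * lookup p m))"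

text \<open>
  Apart from powers of \<open>Gamma (1 + \<alpha>)\<close> and factorials, \<open>phi \<alpha> k\<close> is \<open>Gamma (k * \<alpha> + 1)\<close>. The Gamma
  quotient in \<open>caputo_factor\<close> therefore replaces the Gamma value of \<open>k - 1\<close> by that of \<open>k\<close>, its
  denominator supplies the missing power of \<open>Gamma (1 + \<alpha>)\<close>, and \<open>k / fact k = 1 / fact (k - 1)\<close> accounts for the factor on the right. At \<open>k = 0\<close> both sides vanish,
  whatever value the truncated \<open>k - 1\<close> has.
\<close>

lemma phi_caputo_factor:
  assumes "0 < \<alpha>"
  shows "phi \<alpha> (k - 1) * caputo_factor \<alpha> k = real k * phi \<alpha> k"
proof (cases k)
  case (Suc l)
  have "Gamma (real l * \<alpha> + 1) > 0" "Gamma (1 + \<alpha>) > 0"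
    using assms by (auto intro!: Gamma_real_pos add_nonneg_pos)
  moreover have shift: "real (Suc l) - 1 = real l"
    by simp
  ultimately show ?thesis
    using Suc by (simp add: phi_def caputo_factor_def shift divide_simps del: of_nat_Suc)
qed (simp add: caputo_factor_def)

text \<open>
  Only the factor of the variable \<open>i\<close> changes between the two weights.
\<close>

lemma phi_weight_caputo_factor:
  assumes "0 < \<alpha>"
  shows "phi_weight \<alpha> (m - Poly_Mapping.single i 1) * caputo_factor \<alpha> (lookup m i) =
    real (lookup m i) * phi_weight \<alpha> m"
proof -
  let ?P = "\<Prod>k\<in>UNIV - {i}. phi \<alpha> (lookup m k)"
  have "phi_weight \<alpha> (m - Poly_Mapping.single i 1) = phi \<alpha> (lookup m i - 1) * ?P"
    unfolding phi_weight_def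
    by (subst prod.remove[of _ i]) (auto simp: lookup_minus lookup_single when_def intro!: prod.cong)
  moreover have "phi_weight \<alpha> m = phi \<alpha> (lookup m i) * ?P"
    unfolding phi_weight_def by (subst prod.remove[of _ i]) auto
  ultimately show ?thesis
    using phi_caputo_factor[OF assms, of "lookup m i"] by (simp add: algebra_simps)
qed

text \<open>
  Both sides send \<open>y\<^sup>m\<close> to a multiple of the same monomial, so the identity holds coefficientwise by
  the recursion for the weights.
\<close>

lemma rescale_weighted_partial:
  assumes "0 < \<alpha>"
  shows "rescale (phi_weight \<alpha>) (weighted_partial (caputo_factor \<alpha>) i p) =
    partial_deriv i (rescale (phi_weight \<alpha>) p)"
proof -
  \<comment> \<open>The weights do not vanish, so both operators sum over the same monomials.\<close>
  have keys: "keys (rescale (phi_weight \<alpha>) p) = keys p"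
    using less_imp_neq[OF phi_weight_pos[OF assms]] by (fastforce simp: in_keys_iff lookup_rescale)
  have "phi_weight \<alpha> (m - Poly_Mapping.single i 1) * (caputo_factor \<alpha> (lookup m i) * r) =
      real (lookup m i) * (phi_weight \<alpha> m * r)" for m r
    using phi_weight_caputo_factor[OF assms, of m i] by (metis mult.assoc)
  then show ?thesis
    by (simp only: weighted_partial_def partial_deriv_def rescale_sum rescale_single keys
        lookup_rescale)
qed


section \<open>Fractional polynomials\<close>

lemma zero_in_frac_poly: "0 \<in> frac_poly \<alpha> U"
  by (metis frac_comb_0 frac_comb_in_frac_poly)

lemma minus_in_frac_poly: "f \<in> frac_poly \<alpha> U \<Longrightarrow> - f \<in> frac_poly \<alpha> U"
  by (auto simp: frac_poly_eq image_iff)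
    (metis frac_comb_0 frac_comb_add add.right_inverse minus_unique)

text \<open>
  Fractional polynomials are extended by zero outside \<open>U\<close>, so the indicator of \<open>U\<close>
  is their unit.
\<close>

lemma frac_poly_times_indicator:
  assumes "f \<in> frac_poly \<alpha> U"
  shows "f * indicator U = f"
  using assms by (auto simp: frac_poly_eq fun_eq_iff frac_comb_def frac_monom_def indicator_def)

lemma frac_comb_scale: "frac_comb \<alpha> U (Poly_Mapping.single 0 r * c) = (\<lambda>x. r * frac_comb \<alpha> U c x)"
proof
  fix x
  have "keys (Poly_Mapping.single 0 r * c) \<subseteq> keys c"
    by (auto simp: in_keys_iff lookup_single_0_times)
  then show "frac_comb \<alpha> U (Poly_Mapping.single 0 r * c) x = r * frac_comb \<alpha> U c x"
    by (simp add: frac_comb_superset[of "keys c"] lookup_single_0_times sum_distrib_left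
        mult.assoc)
qed

lemma caputo_monom_eq:
  "caputo_monom \<alpha> U i m x =
     caputo_factor \<alpha> (lookup m i) * frac_monom \<alpha> U (m - Poly_Mapping.single i 1) x"
proof -
  have "(\<Prod>k\<in>UNIV. frac_coord \<alpha> k x ^ lookup (m - Poly_Mapping.single i 1) k) =
      frac_coord \<alpha> i x ^ (lookup m i - 1) * (\<Prod>k\<in>UNIV - {i}. frac_coord \<alpha> k x ^ lookup m k)"
    by (subst prod.remove[of _ i]) (auto simp: lookup_minus lookup_single when_def intro!: prod.cong)
  then show ?thesis
    by (simp add: caputo_monom_def caputo_factor_def frac_monom_def)
qed


section \<open>The comparison map on a box\<close>

text \<open>
  On a box with nonempty interior \<open>frac_coeffs\<close> and \<open>frac_comb\<close> are mutually inverse. Linearity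
  of \<open>frac_coeffs\<close> is therefore linearity of \<open>frac_comb\<close> read backwards.
\<close>

locale frac_box =
  fixes \<alpha> :: real and b :: "real ^ 'n" and U :: "(real ^ 'n) set"
  assumes \<alpha>_pos: "0 < \<alpha>" and b_pos: "\<forall>i. 0 < b $ i"
    and U_eq: "U = {x. \<forall>i. 0 \<le> x $ i \<and> x $ i \<le> b $ i}"
begin

lemma coeffs_comb: "frac_coeffs \<alpha> U (frac_comb \<alpha> U c) = c"
  by (rule frac_coeffs_comb[OF \<alpha>_pos b_pos U_eq])

lemma comb_coeffs: "f \<in> frac_poly \<alpha> U \<Longrightarrow> frac_comb \<alpha> U (frac_coeffs \<alpha> U f) = f"
  by (auto simp: frac_poly_eq coeffs_comb)

lemma bij_coeffs: "bij_betw (frac_coeffs \<alpha> U) (frac_poly \<alpha> U) UNIV"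
  by (rule bij_betw_byWitness[where f' = "frac_comb \<alpha> U"])
    (auto simp: coeffs_comb comb_coeffs frac_comb_in_frac_poly)

lemma coeffs_add:
  assumes "f \<in> frac_poly \<alpha> U" "g \<in> frac_poly \<alpha> U"
  shows "frac_coeffs \<alpha> U (f + g) = frac_coeffs \<alpha> U f + frac_coeffs \<alpha> U g"
  using assms by (auto simp: frac_poly_eq coeffs_comb simp flip: frac_comb_add)

lemma coeffs_0: "frac_coeffs \<alpha> U 0 = 0"
  by (metis frac_comb_0 coeffs_comb)

lemma coeffs_scale:
  assumes "f \<in> frac_poly \<alpha> U"
  shows "frac_coeffs \<alpha> U (\<lambda>x. r * f x) = Poly_Mapping.single 0 r * frac_coeffs \<alpha> U f"
  using assms by (auto simp: frac_poly_eq coeffs_comb simp flip: frac_comb_scale)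

lemma caputo_comb:
  "caputo \<alpha> U i (frac_comb \<alpha> U c) = frac_comb \<alpha> U (weighted_partial (caputo_factor \<alpha>) i c)"
  by (simp add: fun_eq_iff caputo_def coeffs_comb weighted_partial_def frac_comb_sum
      frac_comb_single sum_fun_apply caputo_monom_eq algebra_simps)

definition Phi_coeff :: "(real ^ 'n \<Rightarrow> real) \<Rightarrow> 'n rpoly" where
  "Phi_coeff f = rescale (phi_weight \<alpha>) (frac_coeffs \<alpha> U f)"

text \<open>
  Rescaling monomial by monomial is what the sum over the keys in \<open>Phi\<close> amounts to, because a
  polynomial is the sum of its monomials.
\<close>

lemma Phi_eq: "Phi \<alpha> U \<omega> = (\<lambda>I. Phi_coeff (\<omega> I))"
proof
  fix I
  let ?c = "\<lambda>J. frac_coeffs \<alpha> U (\<omega> J)"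
  let ?s = "\<lambda>J m. Poly_Mapping.single m (phi_weight \<alpha> m * lookup (?c J) m)"
  have "Phi \<alpha> U \<omega> I = (\<Sum>J\<in>UNIV. \<Sum>m\<in>keys (?c J). if J = I then ?s J m else 0)"
    unfolding Phi_def sum_fun_apply
    by (intro sum.cong)
      (auto simp: basis_form_def Phi_monom_def phi_weight_def mult_single algebra_simps)
  also have "\<dots> = (\<Sum>J\<in>UNIV. if J = I then \<Sum>m\<in>keys (?c J). ?s J m else 0)"
    by (intro sum.cong) auto
  also have "\<dots> = rescale (phi_weight \<alpha>) (\<Sum>m\<in>keys (?c I). Poly_Mapping.single m (lookup (?c I) m))"
    by (simp add: rescale_sum rescale_single)
  finally show "Phi \<alpha> U \<omega> I = Phi_coeff (\<omega> I)"
    by (simp add: Phi_coeff_def flip: poly_mapping_sum_single)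
qed

lemma Phi_coeff_comb: "Phi_coeff (frac_comb \<alpha> U c) = rescale (phi_weight \<alpha>) c"
  by (simp add: Phi_coeff_def coeffs_comb)

lemma Phi_coeff_0: "Phi_coeff 0 = 0"
  by (simp add: Phi_coeff_def coeffs_0 rescale_0)

lemma Phi_coeff_add:
  "f \<in> frac_poly \<alpha> U \<Longrightarrow> g \<in> frac_poly \<alpha> U \<Longrightarrow> Phi_coeff (f + g) = Phi_coeff f + Phi_coeff g"
  by (simp add: Phi_coeff_def coeffs_add rescale_add)

lemma Phi_coeff_scale:
  "f \<in> frac_poly \<alpha> U \<Longrightarrow> Phi_coeff (\<lambda>x. r * f x) = Poly_Mapping.single 0 r * Phi_coeff f"
  by (simp add: Phi_coeff_def coeffs_scale rescale_single_0_times)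

lemma bij_Phi_coeff: "bij_betw Phi_coeff (frac_poly \<alpha> U) UNIV"
proof -
  have "bij (rescale (phi_weight \<alpha>))"
    by (rule bij_rescale) (use phi_weight_pos[OF \<alpha>_pos] in \<open>auto simp: less_le\<close>)
  from bij_betw_trans[OF bij_coeffs this] show ?thesis
    by (simp add: Phi_coeff_def[abs_def] comp_def)
qed

lemma caputo_in_frac_poly: "f \<in> frac_poly \<alpha> U \<Longrightarrow> caputo \<alpha> U i f \<in> frac_poly \<alpha> U"
  by (auto simp: frac_poly_eq caputo_comb)

lemma Phi_coeff_caputo:
  "f \<in> frac_poly \<alpha> U \<Longrightarrow> Phi_coeff (caputo \<alpha> U i f) = partial_deriv i (Phi_coeff f)"
  by (auto simp: frac_poly_eq caputo_comb Phi_coeff_comb rescale_weighted_partial[OF \<alpha>_pos])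

lemma Phi_coeff_sum:
  assumes "\<And>a. a \<in> A \<Longrightarrow> f a \<in> frac_poly \<alpha> U"
  shows "Phi_coeff (\<Sum>a\<in>A. f a) = (\<Sum>a\<in>A. Phi_coeff (f a))"
proof -
  have "Phi_coeff (\<Sum>a\<in>A. f a) = (\<Sum>a\<in>A. Phi_coeff (f a)) \<and> (\<Sum>a\<in>A. f a) \<in> frac_poly \<alpha> U"
    using assms
    by (induction A rule: infinite_finite_induct)
      (auto simp: Phi_coeff_0 zero_in_frac_poly Phi_coeff_add frac_poly.add)
  then show ?thesis ..
qed

lemma Phi_coeff_minus: "f \<in> frac_poly \<alpha> U \<Longrightarrow> Phi_coeff (- f) = - Phi_coeff f"
  using Phi_coeff_scale[of f "-1"] by (simp add: fun_Compl_def single_uminus)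

text \<open>
  The signs on the two sides belong to different rings (functions and polynomials), and linearity of
  \<open>Phi_coeff\<close> is over the reals; hence the step through \<open>Phi_coeff_minus\<close>.
\<close>

lemma Phi_coeff_shuffle_sign:
  assumes "f \<in> frac_poly \<alpha> U"
  shows "shuffle_sign I J * f \<in> frac_poly \<alpha> U"
    and "Phi_coeff (shuffle_sign I J * f) = shuffle_sign I J * Phi_coeff f"
  using assms
  by (auto simp: shuffle_sign_def minus_one_power_iff minus_in_frac_poly Phi_coeff_minus)

end

lemma Phi_frac_diff:
  fixes b :: "(real, 'n::{finite,linorder}) vec"
  assumes "frac_box \<alpha> b U" "\<omega> \<in> frac_forms \<alpha> U"
  shows "Phi \<alpha> U (frac_diff \<alpha> U \<omega>) = poly_diff (Phi \<alpha> U \<omega>)"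
proof
  interpret frac_box \<alpha> b U by fact
  have \<omega>: "\<omega> I \<in> frac_poly \<alpha> U" for I
    using assms(2) by (simp add: frac_forms_def forms_def)
  fix K
  let ?D = "\<lambda>i. caputo \<alpha> U i (\<omega> (K - {i}))"
  have D: "?D i \<in> frac_poly \<alpha> U" for i
    by (rule caputo_in_frac_poly[OF \<omega>])
  have "frac_diff \<alpha> U \<omega> K = (\<Sum>i\<in>K. shuffle_sign {i} (K - {i}) * ?D i)"
    using D by (simp add: frac_diff_def ext_diff_apply mult.assoc frac_poly_times_indicator[of _ \<alpha>])
  then have "Phi \<alpha> U (frac_diff \<alpha> U \<omega>) K =
      (\<Sum>i\<in>K. shuffle_sign {i} (K - {i}) * partial_deriv i (Phi_coeff (\<omega> (K - {i}))))"
    using D \<omega> by (simp add: Phi_eq Phi_coeff_sum Phi_coeff_shuffle_sign Phi_coeff_caputo)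
  then show "Phi \<alpha> U (frac_diff \<alpha> U \<omega>) K = poly_diff (Phi \<alpha> U \<omega>) K"
    by (simp add: poly_diff_def ext_diff_apply Phi_eq)
qed

theorem proposition6p2:
  fixes \<alpha> :: real and b :: "(real, 'n::{finite,linorder}) vec" and U :: "(real, 'n) vec set"
  assumes "0 < \<alpha>" and "\<alpha> < 1" and "\<forall>i. 0 < b $ i"
    and "U = {x. \<forall>i. 0 \<le> x $ i \<and> x $ i \<le> b $ i}"
  shows "(\<forall>m. 0 < phi \<alpha> m) \<and>
    (\<forall>\<omega>\<in>frac_forms \<alpha> U. \<forall>\<eta>\<in>frac_forms \<alpha> U. Phi \<alpha> U (\<omega> + \<eta>) = Phi \<alpha> U \<omega> + Phi \<alpha> U \<eta>) \<and>
    (\<forall>c. \<forall>\<omega>\<in>frac_forms \<alpha> U.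
       Phi \<alpha> U (\<lambda>I x. c * \<omega> I x) = (\<lambda>I. Poly_Mapping.single 0 c * Phi \<alpha> U \<omega> I)) \<and>
    bij_betw (Phi \<alpha> U) (frac_forms \<alpha> U) (forms UNIV) \<and>
    (\<forall>p. bij_betw (Phi \<alpha> U) (frac_forms_deg \<alpha> U p) (forms_deg UNIV p)) \<and>
    (\<forall>\<omega>\<in>frac_forms \<alpha> U. Phi \<alpha> U (frac_diff \<alpha> U \<omega>) = poly_diff (Phi \<alpha> U \<omega>))"
proof -
  interpret frac_box \<alpha> b U
    using assms by unfold_locales
  have Phi: "Phi \<alpha> U = (\<lambda>\<omega> I. Phi_coeff (\<omega> I))"
    by (rule ext) (rule Phi_eq)
  have "Phi \<alpha> U (\<omega> + \<eta>) = Phi \<alpha> U \<omega> + Phi \<alpha> U \<eta>"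
    if "\<omega> \<in> frac_forms \<alpha> U" "\<eta> \<in> frac_forms \<alpha> U" for \<omega> \<eta>
    using that by (auto simp: Phi frac_forms_def forms_def Phi_coeff_add)
  moreover have "Phi \<alpha> U (\<lambda>I x. c * \<omega> I x) = (\<lambda>I. Poly_Mapping.single 0 c * Phi \<alpha> U \<omega> I)"
    if "\<omega> \<in> frac_forms \<alpha> U" for c \<omega>
    using that by (auto simp: Phi frac_forms_def forms_def Phi_coeff_scale)
  moreover have "bij_betw (Phi \<alpha> U) (frac_forms \<alpha> U) (forms UNIV)"
    unfolding Phi frac_forms_def by (rule bij_betw_forms[OF bij_Phi_coeff])
  moreover have "bij_betw (Phi \<alpha> U) (frac_forms_deg \<alpha> U p) (forms_deg UNIV p)" for p
    unfolding Phi frac_forms_deg_def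
    by (rule bij_betw_forms_deg[where g = Phi_coeff, OF bij_Phi_coeff zero_in_frac_poly Phi_coeff_0])
  moreover have "Phi \<alpha> U (frac_diff \<alpha> U \<omega>) = poly_diff (Phi \<alpha> U \<omega>)"
    if "\<omega> \<in> frac_forms \<alpha> U" for \<omega>
    using frac_box_axioms that by (rule Phi_frac_diff)
  ultimately show ?thesis
    using phi_pos[OF assms(1)] by blast
qed

end
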